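(* Assume that there exists $g\in\mathcal G^{\ast}$ such that $g\in\mathcal G_{a}^{\ast}$ for every $a\in\mathcal A'$, and that $|\mathcal A'|\ge 2$. Let $a\in\mathcal A'$ be any class pair, and let $\delta\in\Delta$ be a trigger embedding function that minimizes $R^{\mathcal F}_a(Y|X^{\delta})$ over $\Delta$. Then $\delta$ minimizes (over $\Delta$) the quantity $$\min_{f\in\mathcal F_a^{\delta}}\ \sum_{a'\in\mathcal A'\setminus\{a\}} P_{A|A\neq a}(a')\,\mathbb E_{P_{X^{\delta}Y|a'}}\big[l(Y,f(X^{\delta}))\big]$$ if and only if $\delta$ also minimizes $R^{\mathcal F}(Y|X^{\delta})$ over $\Delta$.
   Context: Setting. $\mathcal X$ is the sample space and $\mathcal Y$ a finite label space. A class pair is an element $a=(s,t)\in\mathcal Y\times\mathcal Y$ ($s$ is the source class, $t$ the target class). $\mathcal A'=\{a_1,\dots,a_k\}$ ($k\le|\mathcal Y|$) is an arbitrary set of class pairs such that: $s\ne t$ for every $(s,t)\in\mathcal A'$; distinct elements $(s_i,t_i)\neq(s_j,t_j)$ of $\mathcal A'$ have $s_i\ne s_j$; and $A$ is a random variable with values in $\mathcal A'$ whose law $P_A$ satisfies $P_A(a)>0$ for all $a\in\mathcal A'$. Given $A=a=(s,t)$, the pair $(X,Y)\in\mathcal X\times\mathcal Y$ has law $P_{XY|a}$, with $P_{XY|a}(x,y)=P_{X|s}(x)\cdot\mathbf 1[y=t]$, where $P_{X|s}$ is the distribution of samples of class $s$. The unconditional law is $P_{XY}=\sum_{a\in\mathcal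 A'}P_A(a)P_{XY|a}$. $P_{A|A\ne a}(a')=P_A(a')/(1-P_A(a))$ for $a'\in\mathcal A'\setminus\{a\}$. $\Delta$ is a set of (measurable) trigger embedding functions $\delta:\mathcal X\to\mathcal X$, and $\mathcal F$ is a set of (measurable) classifiers $f:\mathcal X\to\mathcal Y$. For $\delta\in\Delta$ put $X^{\delta}=\delta(X)$; $P_{X^\delta Y}$ and $P_{X^{\delta}Y|a}$ denote the laws of $(\delta(X),Y)$ when $(X,Y)\sim P_{XY}$ and $(X,Y)\sim P_{XY|a}$, respectively. $\mathcal G=\{f\circ\delta: \delta\in\Delta, f\in\mathcal F\}$. The loss $l:\mathcal Y\times\mathcal Y\to\mathbb R$ is the 0-1 loss: $l(y_1,y_2)=0$ if $y_1=y_2$ and $1$ otherwise. Bayes risks and Bayes classifiers (for $\delta\in\Delta$, $a\in\mathcal A'$): - $R^{\mathcal F}(Y|X^{\delta})=\min_{f\in\mathcal F}\mathbb E_{P_{X^{\delta}Y}}[l(Y,f(X^{\delta}))]$. - $R^{\mathcal F}_a(Y|X^{\delta})=\min_{f\in\mathcal F}\mathbb E_{P_{X^{\delta}Y|a}}[l(Y,f(X^{\delta}))]$, and $\mathcal F_a^{\delta}$ is the set of $f\in\mathcal F$ attaining it. - $R^{\mathcal G}(Y|X)=\min_{g\in\mathcal G}\mathbb E_{P_{XY}}[l(Y,g(X))]$, and $\mathcal G^{\ast}$ is the set of $g\in\mathcal G$ attaining it. - $R^{\mathcal G}_a(Y|X)=\min_{g\in\mathcal G}\mathbb E_{P_{XY|a}}[l(Y,g(X))]$,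 and $\mathcal G_a^{\ast}$ is the set of $g\in\mathcal G$ attaining it. Standing assumption: all the minima written with "$\min$" (in these definitions and in the claim) are assumed to exist, i.e. to be attained. *)

theory Defs
  imports "HOL-Probability.Probability"
begin

text \<open>
  The sample space is an arbitrary measurable space \<open>M\<close> over the type \<open>'x\<close>, the label space is a
  finite type \<open>'y\<close> with the discrete sigma-algebra, and a class pair (source, target) is an element
  of \<open>'y \<times> 'y\<close>.  \<open>PX s\<close> is the distribution of the samples of class \<open>s\<close>.  The law of the random
  class pair is the pmf \<open>pA\<close>; that it has values in \<open>A'\<close> and charges every point of \<open>A'\<close> is
  expressed by \<open>set_pmf pA = A'\<close>.
\<close>

definition loss01 :: "'y \<Rightarrow> 'y \<Rightarrow> real" where
  "loss01 y1 y2 = (if y1 = y2 then 0 else 1)"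

text \<open>
  The law of \<open>(X, Y)\<close> given the class pair \<open>a = (s, t)\<close>: the first component is distributed according
  to \<open>PX s\<close> and the second one is the constant \<open>t\<close>.
\<close>

definition law_XY_given ::
  "('y \<Rightarrow> 'x measure) \<Rightarrow> 'y \<times> 'y \<Rightarrow> ('x \<times> 'y) measure" where
  "law_XY_given PX a = PX (fst a) \<Otimes>\<^sub>M return (count_space UNIV) (snd a)"

text \<open>
  The mixture of the conditional laws with weights \<open>pmf pA a\<close>; the lemma \<open>emeasure_law_XY\<close> below
  gives the explicit finite sum.
\<close>

definition law_XY ::
  "('y \<Rightarrow> 'x measure) \<Rightarrow> ('y \<times> 'y) pmf \<Rightarrow> ('x \<times> 'y) measure" where
  "law_XY PX pA = measure_pmf pA \<bind> law_XY_given PX"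

text \<open>The law of \<open>(\<delta> X, Y)\<close> when \<open>(X, Y)\<close> has law \<open>Q\<close>.\<close>

definition trigger_law ::
  "('x \<Rightarrow> 'x) \<Rightarrow> ('x \<times> 'y) measure \<Rightarrow> ('x \<times> 'y) measure" where
  "trigger_law \<delta> Q = distr Q Q (\<lambda>(x, y). (\<delta> x, y))"

definition expected_loss :: "('x \<times> 'y) measure \<Rightarrow> ('x \<Rightarrow> 'y) \<Rightarrow> real" where
  "expected_loss Q f = (\<integral>(x, y). loss01 y (f x) \<partial>Q)"

text \<open>
  Minima over a set are written as infima; in the theorem \<open>min_attained\<close> is assumed for each of
  them, so that they are genuine minima.
\<close>

definition min_attained :: "('b \<Rightarrow> real) \<Rightarrow> 'b set \<Rightarrow> bool" where
  "min_attained h S \<longleftrightarrow> (\<exists>z. is_arg_min h (\<lambda>z. z \<in> S) z)"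

text \<open>
  The Bayes risk and the set of Bayes classifiers within a class \<open>H\<close>, for \<open>(X, Y)\<close> with law \<open>Q\<close>.
  With \<open>Q\<close> one of \<open>trigger_law \<delta> (law_XY PX pA)\<close>, \<open>trigger_law \<delta> (law_XY_given PX a)\<close>,
  \<open>law_XY PX pA\<close> and \<open>law_XY_given PX a\<close>, the first two for \<open>H = F\<close> and the last two for
  \<open>H = composed_class F \<Delta>\<close>, this covers all the risks that occur.
\<close>

definition bayes_risk :: "('x \<Rightarrow> 'y) set \<Rightarrow> ('x \<times> 'y) measure \<Rightarrow> real" where
  "bayes_risk H Q = (INF h\<in>H. expected_loss Q h)"

definition bayes_classifiers ::
  "('x \<Rightarrow> 'y) set \<Rightarrow> ('x \<times> 'y) measure \<Rightarrow> ('x \<Rightarrow> 'y) set" where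
  "bayes_classifiers H Q = {h \<in> H. expected_loss Q h = bayes_risk H Q}"

definition composed_class ::
  "('x \<Rightarrow> 'y) set \<Rightarrow> ('x \<Rightarrow> 'x) set \<Rightarrow> ('x \<Rightarrow> 'y) set" where
  "composed_class F \<Delta> = {f \<circ> \<delta> | f \<delta>. f \<in> F \<and> \<delta> \<in> \<Delta>}"

text \<open>The conditional probability of \<open>a'\<close> given that the class pair is not \<open>a\<close> (for \<open>a' \<noteq> a\<close>).\<close>

definition prob_given_not :: "('y \<times> 'y) pmf \<Rightarrow> 'y \<times> 'y \<Rightarrow> 'y \<times> 'y \<Rightarrow> real" where
  "prob_given_not pA a a' = pmf pA a' / (1 - pmf pA a)"

definition other_pairs_loss ::
  "('y \<Rightarrow> 'x measure) \<Rightarrow> ('y \<times> 'y) pmf \<Rightarrow> ('y \<times> 'y) set \<Rightarrow> 'y \<times> 'y \<Rightarrow>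
     ('x \<Rightarrow> 'x) \<Rightarrow> ('x \<Rightarrow> 'y) \<Rightarrow> real" where
  "other_pairs_loss PX pA A' a \<delta> f =
     (\<Sum>a'\<in>A' - {a}. prob_given_not pA a a' *
        expected_loss (trigger_law \<delta> (law_XY_given PX a')) f)"

lemma sets_law_XY_given:
  assumes "\<And>s. sets (PX s) = sets M"
  shows "sets (law_XY_given PX a) = sets (M \<Otimes>\<^sub>M count_space UNIV)"
  unfolding law_XY_given_def by (intro sets_pair_measure_cong) (simp_all add: assms)

lemma prob_space_law_XY_given:
  assumes "\<And>s. prob_space (PX s)"
  shows "prob_space (law_XY_given PX a)"
proof -
  have "prob_space (return (count_space UNIV) (snd a))" by (rule prob_space_return) simp
  then show ?thesis unfolding law_XY_given_def using assms by (intro prob_space_pair)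
qed

lemma emeasure_law_XY_given:
  fixes PX :: "'y::finite \<Rightarrow> 'x measure"
  assumes "\<And>s. prob_space (PX s)" "B \<in> sets (PX (fst a))"
  shows "emeasure (law_XY_given PX a) (B \<times> {y}) =
    emeasure (PX (fst a)) B * indicator {snd a} y"
proof -
  interpret R: prob_space "return (count_space (UNIV :: 'y set)) (snd a)"
    by (rule prob_space_return) simp
  show ?thesis unfolding law_XY_given_def
    using assms(2) by (subst R.emeasure_pair_measure_Times) (auto simp: indicator_def)
qed

lemma emeasure_law_XY:
  fixes PX :: "'y::finite \<Rightarrow> 'x measure"
  assumes "\<And>s. prob_space (PX s)" "\<And>s. sets (PX s) = sets M" "set_pmf pA = A'"
    and "E \<in> sets (M \<Otimes>\<^sub>M count_space UNIV)"
  shows "emeasure (law_XY PX pA) E =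
    (\<Sum>a\<in>A'. ennreal (pmf pA a) * emeasure (law_XY_given PX a) E)"
proof -
  have "law_XY_given PX \<in> measurable (measure_pmf pA) (subprob_algebra (M \<Otimes>\<^sub>M count_space UNIV))"
    using prob_space_law_XY_given[of PX, OF assms(1)] sets_law_XY_given[of PX M, OF assms(2)]
    by (simp add: space_subprob_algebra prob_space_imp_subprob_space Pi_iff)
  then have "emeasure (law_XY PX pA) E =
      (\<integral>\<^sup>+ a. emeasure (law_XY_given PX a) E \<partial>measure_pmf pA)"
    unfolding law_XY_def by (rule emeasure_bind[rotated]) (use assms(4) in auto)
  also have "\<dots> = (\<Sum>a\<in>A'. ennreal (pmf pA a) * emeasure (law_XY_given PX a) E)"
    by (subst nn_integral_measure_pmf_finite) (auto simp: assms(3) mult.commute)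
  finally show ?thesis .
qed

end

theory Submission
  imports Defs
begin

text \<open>
  By finiteness of the mixture, the total risk of \<open>f \<circ> \<delta>\<close> is a combination with positive weights of
  its risk \<open>u \<delta> f\<close> under the law given \<open>a\<close> and of its risk \<open>v \<delta> f\<close> given the other pairs.  A common
  Bayes classifier \<open>f\<^sub>0 \<circ> \<delta>\<^sub>0\<close> minimizes \<open>u\<close> and \<open>v\<close> at the same time, so both criteria for \<open>\<delta>\<close> say
  that \<open>u \<delta> f\<close> and \<open>v \<delta> f\<close> simultaneously attain their global minima at some \<open>f\<close>.
\<close>

lemma INF_eq_arg_min:
  fixes h :: "'b \<Rightarrow> real"
  assumes "is_arg_min h (\<lambda>z. z \<in> S) z"
  shows "(INF z\<in>S. h z) = h z"
  using assms by (intro cInf_eq_minimum) (auto simp: is_arg_min_linorder)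

lemma min_attainedE:
  assumes "min_attained h S"
  obtains z where "z \<in> S" "h z = (INF z\<in>S. h z)" "\<And>x. x \<in> S \<Longrightarrow> h z \<le> h x"
  using assms INF_eq_arg_min[of h S] unfolding min_attained_def
  by (metis is_arg_min_linorder)

text \<open>On \<open>D\<close>, all inner values are at least \<open>m\<close>, and
  \<open>x0\<close> reaches \<open>m\<close>, so the outer minimum is \<open>m\<close>. Since inner
  minima are attained, \<open>x\<close> realizes it exactly when some \<open>f\<close> in
  \<open>S x\<close> has value \<open>m\<close>. Attainment also makes the real infima meaningful:
  it gives a nonempty \<open>S x\<close> with \<open>h x\<close> bounded below on it.\<close>

lemma is_arg_min_INF_iff:
  fixes h :: "'d \<Rightarrow> 'f \<Rightarrow> real"
  assumes att: "\<And>x. x \<in> D \<Longrightarrow> min_attained (h x) (S x)"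
    and low: "\<And>x f. x \<in> D \<Longrightarrow> f \<in> S x \<Longrightarrow> m \<le> h x f"
    and x0: "x0 \<in> D" "f0 \<in> S x0" "h x0 f0 = m"
  shows "is_arg_min (\<lambda>x. INF f\<in>S x. h x f) (\<lambda>x. x \<in> D) x \<longleftrightarrow> x \<in> D \<and> (\<exists>f\<in>S x. h x f = m)"
proof -
  have ge: "m \<le> (INF f\<in>S y. h y f)" if "y \<in> D" for y
    using att[OF that] low[OF that] by (metis min_attainedE)
  have eq: "(INF f\<in>S y. h y f) = m \<longleftrightarrow> (\<exists>f\<in>S y. h y f = m)" if "y \<in> D" for y
    using att[OF that] low[OF that] by (metis min_attainedE order_antisym)
  have "(INF f\<in>S x0. h x0 f) = m"
    using eq x0 by blast
  then show ?thesis
    unfolding is_arg_min_linorder using ge eq x0(1) by (metis order_antisym)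
qed

text \<open>Abstract core: \<open>u\<close> will be the risk given \<open>a\<close>, and
  \<open>v\<close> the averaged risk given the other pairs. The assumption \<open>x_min\<close> ties
  the two criteria together: it forces the minimizers of \<open>u x\<close> to have the global value
  \<open>u x0 f0\<close>. Otherwise \<open>v\<close> could be smallest over minimizers of
  \<open>u x\<close> whose own value is larger than that.\<close>

lemma arg_min_weighted_sum_iff:
  fixes u v :: "'d \<Rightarrow> 'f \<Rightarrow> real" and c d :: real
  assumes pos: "c > 0" "d > 0"
    and att: "\<And>x. x \<in> D \<Longrightarrow> min_attained (\<lambda>f. c * u x f + d * v x f) F"
    and att_u: "\<And>x. x \<in> D \<Longrightarrow> min_attained (u x) F"
    and att_v: "\<And>x. x \<in> D \<Longrightarrow> min_attained (v x) {f \<in> F. u x f = (INF f\<in>F. u x f)}"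
    and f0: "x0 \<in> D" "f0 \<in> F"
    and low_u: "\<And>x f. x \<in> D \<Longrightarrow> f \<in> F \<Longrightarrow> u x0 f0 \<le> u x f"
    and low_v: "\<And>x f. x \<in> D \<Longrightarrow> f \<in> F \<Longrightarrow> v x0 f0 \<le> v x f"
    and x_min: "is_arg_min (\<lambda>x. INF f\<in>F. u x f) (\<lambda>x. x \<in> D) x"
  shows "is_arg_min (\<lambda>x. INF f\<in>{f \<in> F. u x f = (INF f\<in>F. u x f)}. v x f) (\<lambda>x. x \<in> D) x
    \<longleftrightarrow> is_arg_min (\<lambda>x. INF f\<in>F. c * u x f + d * v x f) (\<lambda>x. x \<in> D) x"
proof -
  let ?S = "\<lambda>x. {f \<in> F. u x f = (INF f\<in>F. u x f)}"
  have "x \<in> D" "\<exists>f\<in>F. u x f = u x0 f0"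
    using x_min is_arg_min_INF_iff[of D u "\<lambda>_. F" "u x0 f0" x0 f0 x] att_u low_u f0 by auto
  have INF_eq: "(INF f\<in>F. u y f) = u x0 f0" if "\<exists>f\<in>F. u y f = u x0 f0" "y \<in> D" for y
    using that low_u by (intro cInf_eq_minimum) (auto intro: rev_image_eqI)
  have INF_x: "(INF f\<in>F. u x f) = u x0 f0"
    using INF_eq \<open>x \<in> D\<close> \<open>\<exists>f\<in>F. u x f = u x0 f0\<close> by blast
  \<comment> \<open>The constraint set at \<open>x0\<close> must contain a point where the lower
    bound \<open>v x0 f0\<close> is reached; \<open>f0\<close> is one, because it minimizes
    \<open>u x0\<close> over \<open>F\<close>.\<close>
  have f0_S: "f0 \<in> ?S x0"
    using f0 INF_eq[of x0] by fastforce
  have "is_arg_min (\<lambda>x. INF f\<in>?S x. v x f) (\<lambda>x. x \<in> D) x \<longleftrightarrow> x \<in> D \<and> (\<exists>f\<in>?S x. v x f = v x0 f0)"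
    using att_v low_v f0(1) f0_S by (intro is_arg_min_INF_iff) auto
  also have "\<dots> \<longleftrightarrow> x \<in> D \<and> (\<exists>f\<in>F. c * u x f + d * v x f = c * u x0 f0 + d * v x0 f0)"
  proof -
    \<comment> \<open>Each weighted term is bounded below by its counterpart at \<open>x0\<close>
      and \<open>f0\<close>, so equality of the sums forces equality term by term, and the positive
      weights cancel.\<close>
    have "c * u x f + d * v x f = c * u x0 f0 + d * v x0 f0 \<longleftrightarrow> u x f = u x0 f0 \<and> v x f = v x0 f0"
      if "f \<in> F" for f
    proof
      assume eq: "c * u x f + d * v x f = c * u x0 f0 + d * v x0 f0"
      have "c * u x0 f0 \<le> c * u x f" "d * v x0 f0 \<le> d * v x f"
        using pos low_u[OF \<open>x \<in> D\<close> that] low_v[OF \<open>x \<in> D\<close> that] by auto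
      with eq have "c * u x f = c * u x0 f0" "d * v x f = d * v x0 f0"
        by linarith+
      then show "u x f = u x0 f0 \<and> v x f = v x0 f0"
        using pos by simp
    qed simp
    \<comment> \<open>By \<open>INF_x\<close>, an \<open>f\<close> in \<open>F\<close> lies in
      \<open>?S x\<close> exactly when \<open>u x f = u x0 f0\<close>.\<close>
    then show ?thesis
      using INF_x by auto
  qed
  also have "\<dots> \<longleftrightarrow> is_arg_min (\<lambda>x. INF f\<in>F. c * u x f + d * v x f) (\<lambda>x. x \<in> D) x"
    using att low_u low_v f0 pos
    by (intro is_arg_min_INF_iff[symmetric]) (auto intro!: add_mono mult_left_mono)
  finally show ?thesis .
qed

lemma measurable_loss01:
  fixes f :: "'x \<Rightarrow> 'y::finite"
  assumes "f \<in> M \<rightarrow>\<^sub>M count_space UNIV"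
  shows "(\<lambda>(x, y). loss01 y (f x)) \<in> borel_measurable (M \<Otimes>\<^sub>M count_space UNIV)"
proof -
  note [measurable] = assms
  \<comment> \<open>There are finitely many labels, so the product of the two discrete spaces is
    discrete and every function on it is measurable.\<close>
  have [measurable]: "(\<lambda>(y, z). loss01 y z)
      \<in> borel_measurable (count_space UNIV \<Otimes>\<^sub>M count_space (UNIV :: 'y set))"
    by (simp add: pair_measure_countable)
  have "(\<lambda>p. (\<lambda>(y, z). loss01 y z) (snd p, f (fst p)))
      \<in> borel_measurable (M \<Otimes>\<^sub>M count_space UNIV)"
    by measurable
  then show ?thesis
    by (simp add: case_prod_beta')
qed

lemma expected_loss_trigger_law:
  fixes f :: "'x \<Rightarrow> 'y::finite"
  assumes Q: "sets Q = sets (M \<Otimes>\<^sub>M count_space UNIV)"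
    and [measurable]: "\<delta> \<in> M \<rightarrow>\<^sub>M M"
    and f: "f \<in> M \<rightarrow>\<^sub>M count_space UNIV"
  shows "expected_loss (trigger_law \<delta> Q) f = expected_loss Q (f \<circ> \<delta>)"
proof -
  have "(\<lambda>(x, y). (\<delta> x, y)) \<in> Q \<rightarrow>\<^sub>M Q"
    unfolding measurable_cong_sets[OF Q Q] by measurable
  moreover have "(\<lambda>(x, y). loss01 y (f x)) \<in> borel_measurable Q"
    using measurable_loss01[OF f] measurable_cong_sets[OF Q refl] by blast
  ultimately show ?thesis
    unfolding expected_loss_def trigger_law_def
    by (subst integral_distr) (simp_all add: case_prod_beta')
qed

text \<open>The 0-1 loss is the indicator of the error event. Passing to its probability lets the
  mixture formula \<open>emeasure_law_XY\<close> apply directly, with no integral over a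
  \<open>bind\<close>.\<close>

lemma expected_loss_eq_measure:
  fixes f :: "'x \<Rightarrow> 'y::finite"
  assumes Q: "sets Q = sets (M \<Otimes>\<^sub>M count_space UNIV)"
  shows "expected_loss Q f = measure Q {p \<in> space (M \<Otimes>\<^sub>M count_space UNIV). loss01 (snd p) (f (fst p)) = 1}"
proof -
  have "expected_loss Q f = (\<integral>p. indicator {p. loss01 (snd p) (f (fst p)) = 1} p \<partial>Q)"
    unfolding expected_loss_def
    by (intro Bochner_Integration.integral_cong) (auto simp: loss01_def)
  \<comment> \<open>If the error event is not measurable, the integral and \<open>measure\<close>
    both default to 0, so \<open>f\<close> may be arbitrary here.\<close>
  also have "\<dots> = measure Q ({p. loss01 (snd p) (f (fst p)) = 1} \<inter> space Q)"
    by simp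
  also have "{p. loss01 (snd p) (f (fst p)) = 1} \<inter> space Q
      = {p \<in> space (M \<Otimes>\<^sub>M count_space UNIV). loss01 (snd p) (f (fst p)) = 1}"
    using sets_eq_imp_space_eq[OF Q] by auto
  finally show ?thesis .
qed

lemma sets_law_XY:
  fixes PX :: "'y::finite \<Rightarrow> 'x measure"
  assumes "\<And>s. sets (PX s) = sets M"
  shows "sets (law_XY PX pA) = sets (M \<Otimes>\<^sub>M count_space UNIV)"
  unfolding law_XY_def using sets_law_XY_given[of PX M, OF assms] by (intro sets_bind) auto

lemma expected_loss_law_XY:
  fixes f :: "'x \<Rightarrow> 'y::finite"
  assumes PX: "\<And>s. prob_space (PX s)" "\<And>s. sets (PX s) = sets M"
    and f: "f \<in> M \<rightarrow>\<^sub>M count_space UNIV"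
  shows "expected_loss (law_XY PX pA) f =
    (\<Sum>a\<in>set_pmf pA. pmf pA a * expected_loss (law_XY_given PX a) f)"
proof -
  let ?E = "{p \<in> space (M \<Otimes>\<^sub>M count_space UNIV). loss01 (snd p) (f (fst p)) = 1}"
  have "?E \<in> sets (M \<Otimes>\<^sub>M count_space UNIV)"
    using measurable_sets[OF measurable_loss01[OF f], of "{1}"]
    by (simp add: vimage_def Int_def case_prod_beta conj_commute)
  then have "emeasure (law_XY PX pA) ?E =
      (\<Sum>a\<in>set_pmf pA. ennreal (pmf pA a) * emeasure (law_XY_given PX a) ?E)"
    using PX by (intro emeasure_law_XY) auto
  \<comment> \<open>The conditional laws are probability measures, hence finite, so the identity can
    be moved from \<open>ennreal\<close> to the reals.\<close>
  also have "\<dots> = (\<Sum>a\<in>set_pmf pA. ennreal (pmf pA a * measure (law_XY_given PX a) ?E))"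
  proof (intro sum.cong refl)
    fix a
    interpret prob_space "law_XY_given PX a"
      using PX(1) by (rule prob_space_law_XY_given)
    show "ennreal (pmf pA a) * emeasure (law_XY_given PX a) ?E
        = ennreal (pmf pA a * measure (law_XY_given PX a) ?E)"
      by (simp add: emeasure_eq_measure ennreal_mult)
  qed
  also have "\<dots> = ennreal (\<Sum>a\<in>set_pmf pA. pmf pA a * measure (law_XY_given PX a) ?E)"
    by (intro sum_ennreal) simp
  finally have "measure (law_XY PX pA) ?E =
      (\<Sum>a\<in>set_pmf pA. pmf pA a * measure (law_XY_given PX a) ?E)"
    by (intro measure_eq_emeasure_eq_ennreal sum_nonneg) auto
  then show ?thesis
    using sets_law_XY[of PX M, OF PX(2)] sets_law_XY_given[of PX M, OF PX(2)]
    by (simp add: expected_loss_eq_measure)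
qed

theorem theorem4p2:
  fixes M :: "'x measure"
    and PX :: "'y::finite \<Rightarrow> 'x measure"
    and A' :: "('y \<times> 'y) set"
    and pA :: "('y \<times> 'y) pmf"
    and \<Delta> :: "('x \<Rightarrow> 'x) set"
    and F :: "('x \<Rightarrow> 'y) set"
    and a :: "'y \<times> 'y"
    and \<delta> :: "'x \<Rightarrow> 'x"
  assumes PX_prob: "\<And>s. prob_space (PX s)"
    and PX_sets: "\<And>s. sets (PX s) = sets M"
    and source_neq_target: "\<And>s t. (s, t) \<in> A' \<Longrightarrow> s \<noteq> t"
    and distinct_sources: "inj_on fst A'"
    and law_A: "set_pmf pA = A'"
    and measurable_triggers: "\<Delta> \<subseteq> M \<rightarrow>\<^sub>M M"
    and measurable_classifiers: "F \<subseteq> M \<rightarrow>\<^sub>M count_space UNIV"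
    and min_F: "\<And>\<delta>'. \<delta>' \<in> \<Delta> \<Longrightarrow>
      min_attained (expected_loss (trigger_law \<delta>' (law_XY PX pA))) F"
    and min_F_given: "\<And>\<delta>' b. \<delta>' \<in> \<Delta> \<Longrightarrow> b \<in> A' \<Longrightarrow>
      min_attained (expected_loss (trigger_law \<delta>' (law_XY_given PX b))) F"
    and min_G: "min_attained (expected_loss (law_XY PX pA)) (composed_class F \<Delta>)"
    and min_G_given: "\<And>b. b \<in> A' \<Longrightarrow>
      min_attained (expected_loss (law_XY_given PX b)) (composed_class F \<Delta>)"
    and min_other: "\<And>\<delta>'. \<delta>' \<in> \<Delta> \<Longrightarrow>
      min_attained (other_pairs_loss PX pA A' a \<delta>')
        (bayes_classifiers F (trigger_law \<delta>' (law_XY_given PX a)))"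
    and common_bayes: "\<exists>g \<in> bayes_classifiers (composed_class F \<Delta>) (law_XY PX pA).
      \<forall>b\<in>A'. g \<in> bayes_classifiers (composed_class F \<Delta>) (law_XY_given PX b)"
    and card_A': "card A' \<ge> 2"
    and a_in: "a \<in> A'"
    and \<delta>_min: "is_arg_min (\<lambda>\<delta>'. bayes_risk F (trigger_law \<delta>' (law_XY_given PX a)))
      (\<lambda>\<delta>'. \<delta>' \<in> \<Delta>) \<delta>"
  shows "is_arg_min
      (\<lambda>\<delta>'. INF f\<in>bayes_classifiers F (trigger_law \<delta>' (law_XY_given PX a)).
         other_pairs_loss PX pA A' a \<delta>' f)
      (\<lambda>\<delta>'. \<delta>' \<in> \<Delta>) \<delta>
    \<longleftrightarrow> is_arg_min (\<lambda>\<delta>'. bayes_risk F (trigger_law \<delta>' (law_XY PX pA))) (\<lambda>\<delta>'. \<delta>' \<in> \<Delta>) \<delta>"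
proof -
  let ?u = "\<lambda>\<delta>' f. expected_loss (trigger_law \<delta>' (law_XY_given PX a)) f"
  let ?v = "other_pairs_loss PX pA A' a"
  let ?p = "pmf pA a"
  have tr_given: "expected_loss (trigger_law \<delta>' (law_XY_given PX b)) f
      = expected_loss (law_XY_given PX b) (f \<circ> \<delta>')" if "\<delta>' \<in> \<Delta>" "f \<in> F" for \<delta>' f b
    using that measurable_triggers measurable_classifiers sets_law_XY_given[of PX M, OF PX_sets]
    by (intro expected_loss_trigger_law) auto
  have "finite A'"
    by simp
  \<comment> \<open>A second pair of positive probability keeps \<open>?p\<close> strictly below 1.
    Thus \<open>1 - ?p\<close> is a positive weight and a legitimate divisor in
    \<open>prob_given_not\<close>.\<close>
  obtain b where b: "b \<in> A'" "b \<noteq> a"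
    using card_A' a_in by (metis One_nat_def card_le_Suc0_iff_eq not_less_eq_eq numeral_2_eq_2 \<open>finite A'\<close>)
  have "?p > 0" "pmf pA b > 0"
    using a_in b law_A by (auto simp: pmf_positive)
  moreover have "?p + pmf pA b \<le> 1"
    using measure_pmf.prob_le_1[of pA "{a, b}"] b by (simp add: measure_measure_pmf_finite)
  ultimately have p: "?p > 0" "1 - ?p > 0"
    by auto
  have total: "expected_loss (trigger_law \<delta>' (law_XY PX pA)) f = ?p * ?u \<delta>' f + (1 - ?p) * ?v \<delta>' f"
    if "\<delta>' \<in> \<Delta>" "f \<in> F" for \<delta>' f
  proof -
    have mf: "f \<in> M \<rightarrow>\<^sub>M count_space UNIV" and md: "\<delta>' \<in> M \<rightarrow>\<^sub>M M"
      using that measurable_triggers measurable_classifiers by auto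
    have "expected_loss (trigger_law \<delta>' (law_XY PX pA)) f = expected_loss (law_XY PX pA) (f \<circ> \<delta>')"
      using sets_law_XY[of PX M, OF PX_sets] md mf by (rule expected_loss_trigger_law)
    also have "\<dots> = (\<Sum>b\<in>A'. pmf pA b * expected_loss (law_XY_given PX b) (f \<circ> \<delta>'))"
      using expected_loss_law_XY[OF PX_prob PX_sets measurable_comp[OF md mf], where pA = pA] law_A by simp
    also have "\<dots> = (\<Sum>b\<in>A'. pmf pA b * expected_loss (trigger_law \<delta>' (law_XY_given PX b)) f)"
      using that by (simp add: tr_given)
    also have "\<dots> = ?p * ?u \<delta>' f
        + (\<Sum>b\<in>A' - {a}. pmf pA b * expected_loss (trigger_law \<delta>' (law_XY_given PX b)) f)"
      using a_in by (simp add: sum.remove)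
    \<comment> \<open>The factor \<open>1 - ?p\<close> cancels the normalization of the law
      conditioned on the pair differing from \<open>a\<close>.\<close>
    also have "(\<Sum>b\<in>A' - {a}. pmf pA b * expected_loss (trigger_law \<delta>' (law_XY_given PX b)) f)
        = (1 - ?p) * ?v \<delta>' f"
      using p by (simp add: other_pairs_loss_def prob_given_not_def sum_distrib_left)
    finally show ?thesis .
  qed
  obtain f0 \<delta>0 where f0: "f0 \<in> F" "\<delta>0 \<in> \<Delta>"
    and bayes: "\<And>b. b \<in> A' \<Longrightarrow>
      expected_loss (law_XY_given PX b) (f0 \<circ> \<delta>0) = bayes_risk (composed_class F \<Delta>) (law_XY_given PX b)"
    using common_bayes by (auto simp: bayes_classifiers_def composed_class_def)
  \<comment> \<open>Minimizing over \<open>composed_class F \<Delta>\<close> is minimizing jointly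
    over triggers and classifiers. Hence the single choice \<open>\<delta>0\<close>,
    \<open>f0\<close> is a lower bound for all others, under every class pair at once.\<close>
  have low: "expected_loss (trigger_law \<delta>0 (law_XY_given PX b)) f0
      \<le> expected_loss (trigger_law \<delta>' (law_XY_given PX b)) f"
    if "b \<in> A'" "\<delta>' \<in> \<Delta>" "f \<in> F" for b \<delta>' f
  proof -
    have "f \<circ> \<delta>' \<in> composed_class F \<Delta>"
      using that by (auto simp: composed_class_def)
    then have "bayes_risk (composed_class F \<Delta>) (law_XY_given PX b) \<le> expected_loss (law_XY_given PX b) (f \<circ> \<delta>')"
      using min_G_given[OF that(1)] unfolding bayes_risk_def by (metis min_attainedE)
    then show ?thesis
      using that f0 by (simp add: tr_given bayes)
  qed
  have low_v: "?v \<delta>0 f0 \<le> ?v \<delta>' f" if "\<delta>' \<in> \<Delta>" "f \<in> F" for \<delta>' f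
    unfolding other_pairs_loss_def using that low p
    by (intro sum_mono mult_left_mono) (auto simp: prob_given_not_def)
  \<comment> \<open>The decomposition \<open>total\<close> holds only for classifiers in
    \<open>F\<close>; \<open>conj_cong\<close> makes that membership available while
    rewriting.\<close>
  have total_att: "min_attained (\<lambda>f. ?p * ?u \<delta>' f + (1 - ?p) * ?v \<delta>' f) F" if "\<delta>' \<in> \<Delta>" for \<delta>'
    using min_F[OF that] total[OF that] by (simp add: min_attained_def is_arg_min_linorder cong: conj_cong)
  have risk: "bayes_risk F (trigger_law \<delta>' (law_XY PX pA)) = (INF f\<in>F. ?p * ?u \<delta>' f + (1 - ?p) * ?v \<delta>' f)"
    if "\<delta>' \<in> \<Delta>" for \<delta>'
    unfolding bayes_risk_def using total[OF that] by (intro INF_cong) auto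
  have "is_arg_min (\<lambda>\<delta>'. INF f\<in>{f \<in> F. ?u \<delta>' f = (INF f\<in>F. ?u \<delta>' f)}. ?v \<delta>' f) (\<lambda>\<delta>'. \<delta>' \<in> \<Delta>) \<delta>
    \<longleftrightarrow> is_arg_min (\<lambda>\<delta>'. INF f\<in>F. ?p * ?u \<delta>' f + (1 - ?p) * ?v \<delta>' f) (\<lambda>\<delta>'. \<delta>' \<in> \<Delta>) \<delta>"
  proof (rule arg_min_weighted_sum_iff[where ?x0.0 = \<delta>0 and ?f0.0 = f0])
    show "min_attained (?v \<delta>') {f \<in> F. ?u \<delta>' f = (INF f\<in>F. ?u \<delta>' f)}" if "\<delta>' \<in> \<Delta>" for \<delta>'
      using min_other[OF that] by (simp add: bayes_classifiers_def bayes_risk_def)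
    show "is_arg_min (\<lambda>\<delta>'. INF f\<in>F. ?u \<delta>' f) (\<lambda>\<delta>'. \<delta>' \<in> \<Delta>) \<delta>"
      using \<delta>_min by (simp add: bayes_risk_def)
  qed (use p f0 a_in low low_v total_att min_F_given in auto)
  \<comment> \<open>The two risk functions need to agree only on \<open>\<Delta>\<close>, the only
    place where \<open>is_arg_min\<close> compares their values.\<close>
  also have "\<dots> \<longleftrightarrow> is_arg_min (\<lambda>\<delta>'. bayes_risk F (trigger_law \<delta>' (law_XY PX pA))) (\<lambda>\<delta>'. \<delta>' \<in> \<Delta>) \<delta>"
    using risk by (auto simp: is_arg_min_linorder)
  finally show ?thesis
    by (simp add: bayes_classifiers_def bayes_risk_def)
qed

end
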